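(* Let $V$ be a separable Hilbert space, $\mathcal{I}$ a finite index set, and $(V_i)_{i\in\mathcal{I}}$ linear subspaces of $V$ with $V=\sum_{i\in\mathcal{I}}V_i$, each equipped with a quadratic norm making it a Hilbert space, $\|v_i\|_{V_i}^2=[Q_i^{-1}v_i,v_i]$ for $v_i\in V_i$, where $Q_i:V_i^*\to V_i$ is a positive symmetric linear bijection. Let $\mathcal{B}=\prod_{i\in\mathcal{I}}V_i$ with $\|u\|_{\mathcal{B}}^2=\sum_{i\in\mathcal{I}}\|u_i\|_{V_i}^2$, let $\Phi:\mathcal{B}\to V$, $\Phi u=\sum_{i\in\mathcal{I}}u_i$, and let $S=\sum_{i\in\mathcal{I}}e_iQ_ie_i^*:V^*\to V$, where $e_i:V_i\to V$ is the inclusion and $e_i^*:V^*\to V_i^*$ its adjoint. Then for every $v\in V$, the minimizer of $\|w\|_{\mathcal{B}}$ over $w\in\mathcal{B}$ with $\Phi w=v$, and therefore the minimizer $w$ of $$\min_{w\in\mathcal{B}:\ \Phi w=v}\ \sup_{u\in\mathcal{B}:\ \Phi u=v}\frac{\|u-w\|_{\mathcal{B}}}{\|u\|_{\mathcal{B}}},$$ is $$\Psi(v)=\big(Q_ie_i^*S^{-1}v\big)_{i\in\mathcal{I}}.$$ Furthermore $\Phi(\Psi(v))=v$ for all $v\in V$, and $$\Psi:(V,\|\cdot\|_{S^{-1}})\to(\mathcal{B},\|\cdot\|_{\mathcal{B}})\quad\text{and}\quad \Phi^*:(V^*,\|\cdot\|_S)\to(\mathcal{B}^*,\|\cdot\|_{\mathcal{B}^*})$$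 are isometries. In particular, writing $\Psi_i(v):=Q_ie_i^*S^{-1}v$, $$\|v\|_{S^{-1}}^2=\|\Psi(v)\|_{\mathcal{B}}^2=\sum_{i\in\mathcal{I}}\|\Psi_i(v)\|_{V_i}^2,\qquad v\in V.$$
   Context: $[\cdot,\cdot]$ denotes the duality product between a dual space (left) and the space (right), both for $(V^*,V)$ and for $(V_i^*,V_i)$, where $V_i^*$ is the topological dual of $(V_i,\|\cdot\|_{V_i})$. A linear bijection $Q_i:V_i^*\to V_i$ is positive symmetric if $[\phi,Q_i\phi]\ge 0$ and $[\phi,Q_i\varphi]=[\varphi,Q_i\phi]$ for all $\phi,\varphi\in V_i^*$. The inclusions $e_i:(V_i,\|\cdot\|_{V_i})\to V$ are assumed continuous, and $[e_i^*\phi,v_i]=[\phi,e_iv_i]$. The operator $S$ is invertible, with $\|v\|_{S^{-1}}^2:=[S^{-1}v,v]$ and $\|\phi\|_S^2:=[\phi,S\phi]$. The dual $\mathcal{B}^*$ is identified with $\prod_{i}V_i^*$ via $[\phi,u]=\sum_i[\phi_i,u_i]$, with dual norm $\|\phi\|_{\mathcal{B}^*}^2=\sum_i[\phi_i,Q_i\phi_i]$. The adjoint $\Phi^*:V^*\to\mathcal{B}^*$ is given by $[\Phi^*\varphi,u]=[\varphi,\Phi u]$, i.e. $\Phi^*\varphi=(e_i^*\varphi)_{i\in\mathcal{I}}$. In the minmax problem the supremum is over nonzero $u$ (supremum over the empty set being $0$). *)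

theory Defs
  imports "HOL-Analysis.Analysis"
begin

text \<open>
  The ambient space \<open>V\<close> is a type with topological dual \<open>'v \<Rightarrow>\<^sub>L real\<close>. A subspace \<open>V\<^sub>i\<close> is a carrier
  set \<open>W\<close> with its own norm \<open>N\<close>, unrelated a priori to the norm of the type; \<open>N\<close> is only meaningful on
  \<open>W\<close>. Functionals on \<open>W\<close> are \<open>extensional\<close> functions, and tuples indexed by \<open>I\<close> are elements of
  \<open>Pi\<^sub>E I\<close>, so that equality of functions is equality on the carrier.
\<close>

definition hilbert_norm_on :: "'v::real_vector set \<Rightarrow> ('v \<Rightarrow> real) \<Rightarrow> bool" where
  "hilbert_norm_on W N \<longleftrightarrow>
     (\<exists>ip :: 'v \<Rightarrow> 'v \<Rightarrow> real.
        (\<forall>x\<in>W. \<forall>y\<in>W. \<forall>z\<in>W. ip (x + y) z = ip x z + ip y z) \<and>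
        (\<forall>c. \<forall>x\<in>W. \<forall>y\<in>W. ip (c *\<^sub>R x) y = c * ip x y) \<and>
        (\<forall>x\<in>W. \<forall>y\<in>W. ip x y = ip y x) \<and>
        (\<forall>x\<in>W. 0 \<le> ip x x) \<and>
        (\<forall>x\<in>W. ip x x = 0 \<longrightarrow> x = 0) \<and>
        (\<forall>x\<in>W. N x = sqrt (ip x x))) \<and>
     (\<forall>X. (\<forall>k::nat. X k \<in> W) \<and> (\<forall>e>0. \<exists>M. \<forall>m\<ge>M. \<forall>n\<ge>M. N (X m - X n) < e) \<longrightarrow>
          (\<exists>x\<in>W. (\<lambda>k. N (X k - x)) \<longlonglongrightarrow> 0))"

definition normed_dual :: "'v::real_vector set \<Rightarrow> ('v \<Rightarrow> real) \<Rightarrow> ('v \<Rightarrow> real) set" where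
  "normed_dual W N =
     {\<phi> \<in> extensional W.
        (\<forall>x\<in>W. \<forall>y\<in>W. \<phi> (x + y) = \<phi> x + \<phi> y) \<and>
        (\<forall>c. \<forall>x\<in>W. \<phi> (c *\<^sub>R x) = c * \<phi> x) \<and>
        (\<exists>C. \<forall>x\<in>W. \<bar>\<phi> x\<bar> \<le> C * N x)}"

definition dual_add :: "'v set \<Rightarrow> ('v \<Rightarrow> real) \<Rightarrow> ('v \<Rightarrow> real) \<Rightarrow> 'v \<Rightarrow> real" where
  "dual_add W \<phi> \<psi> = (\<lambda>x\<in>W. \<phi> x + \<psi> x)"

definition dual_scale :: "'v set \<Rightarrow> real \<Rightarrow> ('v \<Rightarrow> real) \<Rightarrow> 'v \<Rightarrow> real" where
  "dual_scale W c \<phi> = (\<lambda>x\<in>W. c * \<phi> x)"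

definition pos_sym_bijection ::
    "'v::real_vector set \<Rightarrow> ('v \<Rightarrow> real) \<Rightarrow> (('v \<Rightarrow> real) \<Rightarrow> 'v) \<Rightarrow> bool" where
  "pos_sym_bijection W N Q \<longleftrightarrow>
     bij_betw Q (normed_dual W N) W \<and>
     (\<forall>\<phi>\<in>normed_dual W N. \<forall>\<psi>\<in>normed_dual W N. Q (dual_add W \<phi> \<psi>) = Q \<phi> + Q \<psi>) \<and>
     (\<forall>c. \<forall>\<phi>\<in>normed_dual W N. Q (dual_scale W c \<phi>) = c *\<^sub>R Q \<phi>) \<and>
     (\<forall>\<phi>\<in>normed_dual W N. 0 \<le> \<phi> (Q \<phi>)) \<and>
     (\<forall>\<phi>\<in>normed_dual W N. \<forall>\<psi>\<in>normed_dual W N. \<phi> (Q \<psi>) = \<psi> (Q \<phi>))"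

text \<open>The adjoint \<open>e\<^sup>*\<close> of the inclusion of \<open>W\<close> is restriction of functionals to \<open>W\<close>.\<close>

definition incl_adj :: "'v::real_normed_vector set \<Rightarrow> ('v \<Rightarrow>\<^sub>L real) \<Rightarrow> 'v \<Rightarrow> real" where
  "incl_adj W \<phi> = restrict (blinfun_apply \<phi>) W"

definition prod_norm :: "'i set \<Rightarrow> ('i \<Rightarrow> 'v \<Rightarrow> real) \<Rightarrow> ('i \<Rightarrow> 'v) \<Rightarrow> real" where
  "prod_norm I N u = sqrt (\<Sum>i\<in>I. (N i (u i))\<^sup>2)"

definition prod_dual_norm ::
    "'i set \<Rightarrow> ('i \<Rightarrow> ('v \<Rightarrow> real) \<Rightarrow> 'v) \<Rightarrow> ('i \<Rightarrow> 'v \<Rightarrow> real) \<Rightarrow> real" where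
  "prod_dual_norm I Q \<phi> = sqrt (\<Sum>i\<in>I. \<phi> i (Q i (\<phi> i)))"

definition prod_zero :: "'i set \<Rightarrow> 'i \<Rightarrow> 'v::real_vector" where
  "prod_zero I = (\<lambda>i\<in>I. 0)"

definition prod_diff :: "'i set \<Rightarrow> ('i \<Rightarrow> 'v) \<Rightarrow> ('i \<Rightarrow> 'v) \<Rightarrow> 'i \<Rightarrow> 'v::real_vector" where
  "prod_diff I u w = (\<lambda>i\<in>I. u i - w i)"

definition prod_add :: "'i set \<Rightarrow> ('i \<Rightarrow> 'a \<Rightarrow> 'a \<Rightarrow> 'a) \<Rightarrow> ('i \<Rightarrow> 'a) \<Rightarrow> ('i \<Rightarrow> 'a) \<Rightarrow> 'i \<Rightarrow> 'a" where
  "prod_add I ad u w = (\<lambda>i\<in>I. ad i (u i) (w i))"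

definition prod_scale :: "'i set \<Rightarrow> ('i \<Rightarrow> real \<Rightarrow> 'a \<Rightarrow> 'a) \<Rightarrow> real \<Rightarrow> ('i \<Rightarrow> 'a) \<Rightarrow> 'i \<Rightarrow> 'a" where
  "prod_scale I sc c u = (\<lambda>i\<in>I. sc i c (u i))"

definition Phi :: "'i set \<Rightarrow> ('i \<Rightarrow> 'v) \<Rightarrow> 'v::real_vector" where
  "Phi I u = (\<Sum>i\<in>I. u i)"

definition Phi_adj ::
    "'i set \<Rightarrow> ('i \<Rightarrow> 'v set) \<Rightarrow> ('v::real_normed_vector \<Rightarrow>\<^sub>L real) \<Rightarrow> 'i \<Rightarrow> 'v \<Rightarrow> real" where
  "Phi_adj I V \<phi> = (\<lambda>i\<in>I. incl_adj (V i) \<phi>)"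

lemma Phi_adj_duality:
  assumes "u \<in> Pi\<^sub>E I V"
  shows "(\<Sum>i\<in>I. Phi_adj I V \<phi> i (u i)) = blinfun_apply \<phi> (Phi I u)"
  using assms by (auto simp: Phi_adj_def incl_adj_def Phi_def blinfun.sum_right intro!: sum.cong)

definition S_op ::
    "'i set \<Rightarrow> ('i \<Rightarrow> 'v set) \<Rightarrow> ('i \<Rightarrow> ('v \<Rightarrow> real) \<Rightarrow> 'v) \<Rightarrow> ('v::real_normed_vector \<Rightarrow>\<^sub>L real) \<Rightarrow> 'v" where
  "S_op I V Q \<phi> = (\<Sum>i\<in>I. Q i (incl_adj (V i) \<phi>))"

definition S_norm ::
    "'i set \<Rightarrow> ('i \<Rightarrow> 'v set) \<Rightarrow> ('i \<Rightarrow> ('v \<Rightarrow> real) \<Rightarrow> 'v) \<Rightarrow> ('v::real_normed_vector \<Rightarrow>\<^sub>L real) \<Rightarrow> real" where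
  "S_norm I V Q \<phi> = sqrt (blinfun_apply \<phi> (S_op I V Q \<phi>))"

definition S_inv_norm ::
    "'i set \<Rightarrow> ('i \<Rightarrow> 'v set) \<Rightarrow> ('i \<Rightarrow> ('v \<Rightarrow> real) \<Rightarrow> 'v) \<Rightarrow> 'v::real_normed_vector \<Rightarrow> real" where
  "S_inv_norm I V Q v = sqrt (blinfun_apply (inv (S_op I V Q) v) v)"

definition Psi ::
    "'i set \<Rightarrow> ('i \<Rightarrow> 'v set) \<Rightarrow> ('i \<Rightarrow> ('v \<Rightarrow> real) \<Rightarrow> 'v) \<Rightarrow> 'v::real_normed_vector \<Rightarrow> 'i \<Rightarrow> 'v" where
  "Psi I V Q v = (\<lambda>i\<in>I. Q i (incl_adj (V i) (inv (S_op I V Q) v)))"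

text \<open>
  The supremum is taken in \<open>ennreal\<close>: it can be infinite (for \<open>v = 0\<close>), and over the empty set it is \<open>0\<close>.
\<close>

definition worst_rel_error ::
    "'i set \<Rightarrow> ('i \<Rightarrow> 'v set) \<Rightarrow> ('i \<Rightarrow> 'v \<Rightarrow> real) \<Rightarrow> 'v::real_vector \<Rightarrow> ('i \<Rightarrow> 'v) \<Rightarrow> ennreal" where
  "worst_rel_error I V N v w =
     (SUP u \<in> {u \<in> Pi\<^sub>E I V. Phi I u = v \<and> u \<noteq> prod_zero I}.
        ennreal (prod_norm I N (prod_diff I u w) / prod_norm I N u))"

definition linear_isometry ::
    "('a::real_vector \<Rightarrow> real) \<Rightarrow> 'b set \<Rightarrow> ('b \<Rightarrow> 'b \<Rightarrow> 'b) \<Rightarrow> (real \<Rightarrow> 'b \<Rightarrow> 'b) \<Rightarrow> ('b \<Rightarrow> real)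
      \<Rightarrow> ('a \<Rightarrow> 'b) \<Rightarrow> bool" where
  "linear_isometry nA B ad sc nB f \<longleftrightarrow>
     (\<forall>x. f x \<in> B) \<and>
     (\<forall>x y. f (x + y) = ad (f x) (f y)) \<and>
     (\<forall>c x. f (c *\<^sub>R x) = sc c (f x)) \<and>
     (\<forall>x. nB (f x) = nA x)"

end

theory Submission
  imports Defs
begin

text \<open>
  For \<open>v = \<Phi> u\<close>, the number \<open>[\<phi>, v] = \<Sum>\<^sub>i [e\<^sub>i\<^sup>* \<phi>, u\<^sub>i]\<close> is bounded on the unit ball of the quadratic form
  \<open>[\<phi>, S \<phi>]\<close>, so by uniform boundedness the form is coercive, and the Lax-Milgram argument (a Banach
  fixed point) makes \<open>S\<close> bijective. With \<open>\<phi> = S\<^sup>-\<^sup>1 v\<close>, the tuple \<open>\<Psi> v\<close> lies in the fibre over \<open>v\<close> and is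
  orthogonal to \<open>ker \<Phi>\<close>, since its inner product with \<open>k\<close> is \<open>[\<phi>, \<Phi> k]\<close>. Everything else is Pythagoras;
  for the minmax problem, the worst relative error is at most 1 at \<open>\<Psi> v\<close> and exceeds 1 elsewhere on
  the fibre.
\<close>

section \<open>Tools from functional analysis: uniform boundedness and Lax-Milgram\<close>

text \<open>Baire category: the closed sets \<open>F n\<close> cover the complete space, so one of
  them contains a ball, and linearity in \<open>v\<close> moves the bound from that ball to one
  centred at 0.\<close>

lemma pointwise_bounded_imp_bounded:
  fixes Y :: "'v::{real_inner, complete_space} set"
  assumes "\<And>v. \<exists>C. \<forall>y\<in>Y. \<bar>y \<bullet> v\<bar> \<le> C"
  shows "bounded Y"
proof -
  define F where "F n = {v. \<forall>y\<in>Y. \<bar>y \<bullet> v\<bar> \<le> real n}" for n :: nat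
  have F_closed: "closed (F n)" for n
  proof -
    have "F n = (\<Inter>y\<in>Y. {v. \<bar>y \<bullet> v\<bar> \<le> real n})"
      by (auto simp: F_def)
    then show ?thesis
      by (auto intro!: closed_INT closed_Collect_le continuous_intros)
  qed
  have "v \<in> (\<Union>n. F n)" for v
  proof -
    obtain C where C: "\<forall>y\<in>Y. \<bar>y \<bullet> v\<bar> \<le> C"
      using assms by blast
    obtain n :: nat where "C \<le> real n"
      using real_arch_simple by blast
    with C have "v \<in> F n"
      by (force simp: F_def)
    then show ?thesis
      by blast
  qed
  then have "(\<Union>n. F n) = UNIV"
    by blast
  then have "euclidean interior_of \<Union>(range F) \<noteq> {}"
    by simp
  moreover have "completely_metrizable_space (euclidean :: 'v topology)"
    by (rule completely_metrizable_space_euclidean)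
  ultimately obtain n where "interior (F n) \<noteq> {}"
    using Baire_category_alt[of "euclidean :: 'v topology" "range F"] F_closed
    by auto
  then obtain x r where r: "r > 0" "cball x r \<subseteq> F n"
    by (metis equals0I mem_interior_cball)
  have "norm y \<le> 2 * real n / r" if y: "y \<in> Y" for y
  proof (cases "y = 0")
    case False
    \<comment> \<open>\<open>z\<close> points along \<open>y\<close> and just reaches the boundary
      of the ball, so the bounds at \<open>x + z\<close> and at \<open>x\<close> control
      \<open>y \<bullet> z\<close>, which is \<open>r * norm y\<close>.\<close>
    define z where "z = (r / norm y) *\<^sub>R y"
    have "norm z = r"
      using r False by (simp add: z_def)
    then have "x + z \<in> F n" "x \<in> F n"
      using r by (auto simp: subset_iff mem_cball dist_norm)
    then have "\<bar>y \<bullet> (x + z)\<bar> \<le> real n" "\<bar>y \<bullet> x\<bar> \<le> real n"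
      using y by (auto simp: F_def)
    then have "y \<bullet> z \<le> 2 * real n"
      by (simp add: inner_add_right abs_le_iff)
    moreover have "y \<bullet> z = r * norm y"
      using False by (simp add: z_def dot_square_norm power2_eq_square)
    ultimately show ?thesis
      using r by (simp add: field_simps)
  qed (use r in auto)
  then show ?thesis
    by (auto simp: bounded_iff)
qed

lemma norm_diff_scaleR_sq:
  fixes x y :: "'v::real_inner"
  shows "(norm (x - a *\<^sub>R y))\<^sup>2 = (norm x)\<^sup>2 - 2 * a * (x \<bullet> y) + a\<^sup>2 * (norm y)\<^sup>2"
proof -
  have "(x - a *\<^sub>R y) \<bullet> (x - a *\<^sub>R y) = x \<bullet> x - a * (x \<bullet> y) - (a * (x \<bullet> y) - a * (a * (y \<bullet> y)))"
    by (simp only: inner_diff_left inner_diff_right inner_scaleR_left inner_scaleR_right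
        inner_commute[of y x] right_diff_distrib)
  also have "\<dots> = x \<bullet> x - 2 * a * (x \<bullet> y) + a\<^sup>2 * (y \<bullet> y)"
    by (simp only: power2_eq_square)
  finally show ?thesis
    by (simp only: power2_norm_eq_inner)
qed

text \<open>A solution of \<open>T z = v\<close> is a fixed point of
  \<open>z - a *\<^sub>R (T z - v)\<close>, and coercivity makes this map a contraction for a
  suitable step size \<open>a\<close>.\<close>

lemma lax_milgram_surj:
  fixes T :: "'v::{real_inner, complete_space} \<Rightarrow> 'v"
  assumes "linear T"
    and bound: "\<And>z. norm (T z) \<le> M * norm z"
    and "c > 0" and coercive: "\<And>z. c * (norm z)\<^sup>2 \<le> z \<bullet> T z"
  shows "surj T"
proof -
  interpret linear T by fact
  \<comment> \<open>Adding \<open>c\<close> keeps \<open>K\<close> positive and at least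
    \<open>c\<close>, so that the radicand in \<open>q\<close> lies in [0, 1).\<close>
  define K where "K = \<bar>M\<bar> + c"
  have K: "K > 0" "c \<le> K"
    using \<open>c > 0\<close> by (auto simp: K_def)
  have bound': "norm (T z) \<le> K * norm z" for z
  proof -
    have "M \<le> K"
      using \<open>c > 0\<close> by (simp add: K_def)
    then show ?thesis
      using bound[of z] mult_right_mono[of M K "norm z"] by simp
  qed
  \<comment> \<open>This \<open>a\<close> minimizes
    \<open>1 - 2 * a * c + a\<^sup>2 * K\<^sup>2\<close>, the bound for the squared contraction
    factor; the minimum is \<open>q\<^sup>2\<close>.\<close>
  define a where "a = c / K\<^sup>2"
  define q where "q = sqrt (1 - (c / K)\<^sup>2)"
  have "0 < c / K" "c / K \<le> 1"
    using K \<open>c > 0\<close> by auto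
  then have cK: "0 < (c / K)\<^sup>2" "(c / K)\<^sup>2 \<le> 1"
    by (auto simp: power_le_one)
  then have q: "0 \<le> q" "q < 1"
    by (auto simp: q_def)
  have contr: "norm (z - a *\<^sub>R T z) \<le> q * norm z" for z
  proof -
    have "(norm (z - a *\<^sub>R T z))\<^sup>2 = (norm z)\<^sup>2 - 2 * a * (z \<bullet> T z) + a\<^sup>2 * (norm (T z))\<^sup>2"
      by (rule norm_diff_scaleR_sq)
    also have "\<dots> \<le> (norm z)\<^sup>2 - 2 * a * (c * (norm z)\<^sup>2) + a\<^sup>2 * (K * norm z)\<^sup>2"
    proof -
      have "0 \<le> a"
        using \<open>c > 0\<close> by (simp add: a_def)
      then show ?thesis
        using coercive[of z] bound'[of z]
        by (intro add_mono diff_mono mult_left_mono power_mono order_refl) simp_all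
    qed
    also have "\<dots> = (1 - (c / K)\<^sup>2) * (norm z)\<^sup>2"
    proof -
      have "a * c = (c / K)\<^sup>2" "a\<^sup>2 * K\<^sup>2 = (c / K)\<^sup>2"
        using K by (simp_all add: a_def power2_eq_square)
      then show ?thesis
        by (simp only: power_mult_distrib left_diff_distrib mult_1_left flip: mult.assoc)
          (simp only: mult.assoc)
    qed
    also have "\<dots> = (q * norm z)\<^sup>2"
      using cK by (simp add: q_def power_mult_distrib)
    finally show ?thesis
      by (rule power2_le_imp_le) (simp add: q)
  qed
  have "\<exists>z. T z = v" for v
  proof -
    define f where "f z = z - a *\<^sub>R (T z - v)" for z
    have "dist (f x) (f y) \<le> q * dist x y" for x y
    proof -
      have "f x - f y = (x - y) - a *\<^sub>R T (x - y)"
        unfolding f_def diff by (simp add: scaleR_diff_right)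
      then show ?thesis
        using contr[of "x - y"] by (simp add: dist_norm)
    qed
    then obtain z where "f z = z"
      using banach_fix_type[of q f] q by blast
    then show ?thesis
      using K \<open>c > 0\<close> by (auto simp: f_def a_def)
  qed
  then show ?thesis
    unfolding surj_def by metis
qed

lemma normed_dualI:
  assumes "\<phi> \<in> extensional W"
    "\<And>x y. x \<in> W \<Longrightarrow> y \<in> W \<Longrightarrow> \<phi> (x + y) = \<phi> x + \<phi> y"
    "\<And>c x. x \<in> W \<Longrightarrow> \<phi> (c *\<^sub>R x) = c * \<phi> x"
    "\<And>x. x \<in> W \<Longrightarrow> \<bar>\<phi> x\<bar> \<le> C * N x"
  shows "\<phi> \<in> normed_dual W N"
  using assms unfolding normed_dual_def by blast

section \<open>A single subspace with its quadratic norm\<close>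

text \<open>Inner products on \<open>W\<close> are computed as duality pairings:
  \<open>\<psi> x\<close> is the inner product of \<open>Q \<psi>\<close> with
  \<open>x\<close>.\<close>

locale quadratic_space =
  fixes W :: "'v::real_vector set" and N :: "'v \<Rightarrow> real" and Q :: "('v \<Rightarrow> real) \<Rightarrow> 'v"
  assumes subspace_W: "subspace W"
    and hilbert: "hilbert_norm_on W N"
    and pos_sym: "pos_sym_bijection W N Q"
    and norm_Q: "\<And>x. x \<in> W \<Longrightarrow> (N x)\<^sup>2 = inv_into (normed_dual W N) Q x x"
begin

abbreviation "D \<equiv> normed_dual W N"

lemma N_eq_0_imp: "x \<in> W \<Longrightarrow> N x = 0 \<Longrightarrow> x = 0"
  using hilbert by (auto simp: hilbert_norm_on_def)

lemma Q_bij: "bij_betw Q D W"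
  using pos_sym by (simp add: pos_sym_bijection_def)

lemma Q_in: "\<psi> \<in> D \<Longrightarrow> Q \<psi> \<in> W"
  using Q_bij by (rule bij_betwE[THEN bspec])

lemma Q_add: "\<psi> \<in> D \<Longrightarrow> \<eta> \<in> D \<Longrightarrow> Q (dual_add W \<psi> \<eta>) = Q \<psi> + Q \<eta>"
  using pos_sym by (simp add: pos_sym_bijection_def)

lemma Q_scale: "\<psi> \<in> D \<Longrightarrow> Q (dual_scale W c \<psi>) = c *\<^sub>R Q \<psi>"
  using pos_sym by (simp add: pos_sym_bijection_def)

lemma Q_sym: "\<psi> \<in> D \<Longrightarrow> \<eta> \<in> D \<Longrightarrow> \<psi> (Q \<eta>) = \<eta> (Q \<psi>)"
  using pos_sym by (simp add: pos_sym_bijection_def)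

lemma dual_add_apply: "\<psi> \<in> D \<Longrightarrow> x \<in> W \<Longrightarrow> y \<in> W \<Longrightarrow> \<psi> (x + y) = \<psi> x + \<psi> y"
  by (simp add: normed_dual_def)

lemma dual_scale_apply: "\<psi> \<in> D \<Longrightarrow> x \<in> W \<Longrightarrow> \<psi> (c *\<^sub>R x) = c * \<psi> x"
  by (simp add: normed_dual_def)

lemma dual_add_in:
  assumes "\<psi> \<in> D" "\<eta> \<in> D"
  shows "dual_add W \<psi> \<eta> \<in> D"
proof -
  obtain A B where AB: "\<forall>x\<in>W. \<bar>\<psi> x\<bar> \<le> A * N x" "\<forall>x\<in>W. \<bar>\<eta> x\<bar> \<le> B * N x"
    using assms by (auto simp: normed_dual_def)
  have "\<bar>\<psi> x + \<eta> x\<bar> \<le> (A + B) * N x" if "x \<in> W" for x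
    using AB that by (smt (verit, best) distrib_right)
  then show ?thesis
    using assms subspace_W
    by (intro normed_dualI[where C = "A + B"])
      (simp_all add: dual_add_def subspace_add subspace_scale dual_add_apply dual_scale_apply
        distrib_left)
qed

lemma dual_scale_in:
  assumes "\<psi> \<in> D"
  shows "dual_scale W c \<psi> \<in> D"
proof -
  obtain A where A: "\<forall>x\<in>W. \<bar>\<psi> x\<bar> \<le> A * N x"
    using assms by (auto simp: normed_dual_def)
  have "\<bar>c * \<psi> x\<bar> \<le> (\<bar>c\<bar> * A) * N x" if "x \<in> W" for x
    using A that by (simp add: abs_mult mult.assoc mult_left_mono)
  then show ?thesis
    using assms subspace_W
    by (intro normed_dualI[where C = "\<bar>c\<bar> * A"])
      (simp_all add: dual_scale_def subspace_add subspace_scale dual_add_apply dual_scale_apply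
        distrib_left)
qed

lemma N_Q_sq: "\<psi> \<in> D \<Longrightarrow> (N (Q \<psi>))\<^sup>2 = \<psi> (Q \<psi>)"
  using norm_Q[OF Q_in] Q_bij by (simp add: bij_betw_inv_into_left)

text \<open>With \<open>x = Q \<eta>\<close>, the left side is the pairing of
  \<open>\<psi> + t \<eta>\<close> with its own image under \<open>Q\<close>; symmetry of
  \<open>Q\<close> makes both cross terms equal to \<open>t * \<psi> x\<close>.\<close>

lemma N_expand:
  assumes \<psi>: "\<psi> \<in> D" and x: "x \<in> W"
  shows "(N (Q \<psi> + t *\<^sub>R x))\<^sup>2 = (N (Q \<psi>))\<^sup>2 + 2 * t * \<psi> x + t\<^sup>2 * (N x)\<^sup>2"
proof -
  obtain \<eta> where \<eta>: "\<eta> \<in> D" "x = Q \<eta>"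
    using x Q_bij by (metis bij_betw_imp_surj_on imageE)
  let ?\<theta> = "dual_add W \<psi> (dual_scale W t \<eta>)"
  have \<theta>: "?\<theta> \<in> D" "Q ?\<theta> = Q \<psi> + t *\<^sub>R x"
    using \<psi> \<eta> by (auto simp: dual_add_in dual_scale_in Q_add Q_scale)
  have "Q \<psi> + t *\<^sub>R x \<in> W" "t *\<^sub>R x \<in> W"
    using \<psi> x subspace_W by (auto simp: Q_in subspace_add subspace_scale)
  moreover have "(N (Q \<psi> + t *\<^sub>R x))\<^sup>2 = ?\<theta> (Q \<psi> + t *\<^sub>R x)"
    using N_Q_sq[OF \<theta>(1)] \<theta>(2) by simp
  ultimately have "(N (Q \<psi> + t *\<^sub>R x))\<^sup>2
      = \<psi> (Q \<psi>) + t * \<psi> x + t * (\<eta> (Q \<psi>) + t * \<eta> x)"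
    using \<psi> x \<eta>(1)
    by (simp add: dual_add_def dual_scale_def dual_add_apply dual_scale_apply Q_in)
  moreover have "\<eta> (Q \<psi>) = \<psi> x" "\<eta> x = (N x)\<^sup>2"
    using \<psi> \<eta> Q_sym N_Q_sq by auto
  ultimately show ?thesis
    using N_Q_sq[OF \<psi>] by (simp add: power2_eq_square algebra_simps)
qed

lemma N_scale_sq:
  assumes "x \<in> W"
  shows "(N (t *\<^sub>R x))\<^sup>2 = t\<^sup>2 * (N x)\<^sup>2"
proof -
  obtain \<eta> where \<eta>: "\<eta> \<in> D" "x = Q \<eta>"
    using assms Q_bij by (metis bij_betw_imp_surj_on imageE)
  have "(N (t *\<^sub>R x))\<^sup>2 = dual_scale W t \<eta> (t *\<^sub>R x)"
    using N_Q_sq[OF dual_scale_in[OF \<eta>(1), of t]] \<eta> by (simp add: Q_scale)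
  then show ?thesis
    using \<eta> assms N_Q_sq[OF \<eta>(1)] subspace_W
    by (simp add: dual_scale_def dual_scale_apply subspace_scale power2_eq_square)
qed

text \<open>Both squares of \<open>N (Q \<psi> \<plusminus> x)\<close> are nonnegative. This
  Young-type form of Cauchy-Schwarz can be summed over the index set without square roots.\<close>

lemma dual_apply_bound:
  assumes "\<psi> \<in> D" "x \<in> W"
  shows "2 * \<bar>\<psi> x\<bar> \<le> \<psi> (Q \<psi>) + (N x)\<^sup>2"
  using N_expand[OF assms, of 1] N_expand[OF assms, of "-1"] N_Q_sq[OF assms(1)]
    zero_le_power2[of "N (Q \<psi> + x)"] zero_le_power2[of "N (Q \<psi> - x)"]
  by (simp add: abs_le_iff)

lemma dual_eq_0:
  assumes "\<psi> \<in> D" "\<psi> (Q \<psi>) = 0" "x \<in> W"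
  shows "\<psi> x = 0"
proof -
  have "N (Q \<psi>) = 0"
    using N_Q_sq[OF assms(1)] assms(2) by simp
  then have "Q \<psi> = 0"
    using N_eq_0_imp[OF Q_in[OF assms(1)]] by blast
  \<comment> \<open>\<open>dual_scale W 0 \<psi>\<close> stands for the zero functional; injectivity
    of \<open>Q\<close> then identifies \<open>\<psi>\<close> with it.\<close>
  then have "Q (dual_scale W 0 \<psi>) = Q \<psi>"
    using assms by (simp add: Q_scale)
  then have "dual_scale W 0 \<psi> = \<psi>"
    using Q_bij assms dual_scale_in by (meson bij_betw_imp_inj_on inj_onD)
  then have "dual_scale W 0 \<psi> x = \<psi> x"
    by (rule fun_cong)
  then show ?thesis
    using assms(3) by (simp add: dual_scale_def)
qed

end

section \<open>The operator \<open>S\<close> and its invertibility\<close>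

locale subspace_family =
  fixes I :: "'i set"
    and V :: "'i \<Rightarrow> 'v::{real_inner, complete_space} set"
    and N :: "'i \<Rightarrow> 'v \<Rightarrow> real"
    and Q :: "'i \<Rightarrow> ('v \<Rightarrow> real) \<Rightarrow> 'v"
  assumes finite_I: "finite I"
    and sum_V: "{\<Sum>i\<in>I. u i | u. u \<in> Pi\<^sub>E I V} = UNIV"
    and quadratic: "\<And>i. i \<in> I \<Longrightarrow> quadratic_space (V i) (N i) (Q i)"
    and incl_continuous: "\<And>i. i \<in> I \<Longrightarrow> \<exists>C. \<forall>x\<in>V i. norm x \<le> C * N i x"
begin

abbreviation "S \<equiv> S_op I V Q"

lemma subspace_V: "i \<in> I \<Longrightarrow> subspace (V i)"
  using quadratic quadratic_space.subspace_W by blast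

lemma decomposition: obtains u where "u \<in> Pi\<^sub>E I V" "Phi I u = v"
proof -
  have "v \<in> {\<Sum>i\<in>I. u i | u. u \<in> Pi\<^sub>E I V}"
    by (simp only: sum_V UNIV_I)
  then show ?thesis
    using that unfolding Phi_def by blast
qed

lemma incl_adj_apply: "x \<in> V i \<Longrightarrow> incl_adj (V i) \<phi> x = blinfun_apply \<phi> x"
  by (simp add: incl_adj_def)

lemma incl_adj_add: "incl_adj (V i) (\<phi> + \<psi>) = dual_add (V i) (incl_adj (V i) \<phi>) (incl_adj (V i) \<psi>)"
  by (auto simp: incl_adj_def dual_add_def blinfun.add_left)

lemma incl_adj_scale: "incl_adj (V i) (c *\<^sub>R \<phi>) = dual_scale (V i) c (incl_adj (V i) \<phi>)"
  by (auto simp: incl_adj_def dual_scale_def blinfun.scaleR_left)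

lemma incl_adj_in:
  assumes "i \<in> I"
  shows "incl_adj (V i) \<phi> \<in> normed_dual (V i) (N i)"
proof -
  obtain C where C: "\<forall>x\<in>V i. norm x \<le> C * N i x"
    using incl_continuous[OF assms] by blast
  have "\<bar>blinfun_apply \<phi> x\<bar> \<le> (norm \<phi> * C) * N i x" if "x \<in> V i" for x
  proof -
    have "\<bar>blinfun_apply \<phi> x\<bar> \<le> norm \<phi> * norm x"
      using norm_blinfun[of \<phi> x] by simp
    also have "\<dots> \<le> norm \<phi> * (C * N i x)"
      using C that by (simp add: mult_left_mono)
    finally show ?thesis
      by (simp add: mult.assoc)
  qed
  then show ?thesis
    using subspace_V[OF assms]
    by (intro normed_dualI[where C = "norm \<phi> * C"])
      (simp_all add: incl_adj_def subspace_add subspace_scale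
        blinfun.add_right blinfun.scaleR_right)
qed

lemma Q_incl_adj_in: "i \<in> I \<Longrightarrow> Q i (incl_adj (V i) \<phi>) \<in> V i"
  using quadratic quadratic_space.Q_in incl_adj_in by blast

lemma N_Q_incl_adj_sq:
  "i \<in> I \<Longrightarrow> (N i (Q i (incl_adj (V i) \<phi>)))\<^sup>2 = incl_adj (V i) \<phi> (Q i (incl_adj (V i) \<phi>))"
  by (simp add: quadratic_space.N_Q_sq[OF quadratic] incl_adj_in)

lemma Q_incl_adj_add:
  "i \<in> I \<Longrightarrow> Q i (incl_adj (V i) (\<phi> + \<psi>)) = Q i (incl_adj (V i) \<phi>) + Q i (incl_adj (V i) \<psi>)"
  by (simp add: incl_adj_add quadratic_space.Q_add[OF quadratic] incl_adj_in)

lemma Q_incl_adj_scale: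
  "i \<in> I \<Longrightarrow> Q i (incl_adj (V i) (c *\<^sub>R \<phi>)) = c *\<^sub>R Q i (incl_adj (V i) \<phi>)"
  by (simp add: incl_adj_scale quadratic_space.Q_scale[OF quadratic] incl_adj_in)

lemma linear_S: "linear S"
  by (rule linearI)
    (simp_all add: S_op_def Q_incl_adj_add Q_incl_adj_scale sum.distrib scaleR_sum_right)

text \<open>By \<open>N_Q_sq\<close>, each pairing of \<open>incl_adj (V i) \<phi>\<close> with its
  image under \<open>Q i\<close> is a squared norm. Both isometries rest on this identity.\<close>

lemma S_quadratic: "blinfun_apply \<phi> (S \<phi>) = (\<Sum>i\<in>I. (N i (Q i (incl_adj (V i) \<phi>)))\<^sup>2)"
  by (simp add: S_op_def blinfun.sum_right N_Q_incl_adj_sq incl_adj_apply Q_incl_adj_in)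

text \<open>A vanishing sum of squares kills the restriction of \<open>\<phi>\<close> to every
  \<open>V i\<close>, and these subspaces together span the space.\<close>

lemma S_definite:
  assumes "blinfun_apply \<phi> (S \<phi>) = 0"
  shows "\<phi> = 0"
proof (rule blinfun_eqI)
  fix v
  obtain u where u: "u \<in> Pi\<^sub>E I V" "Phi I u = v"
    by (rule decomposition)
  have "(\<Sum>i\<in>I. (N i (Q i (incl_adj (V i) \<phi>)))\<^sup>2) = 0"
    using assms by (simp only: S_quadratic)
  then have "\<forall>i\<in>I. (N i (Q i (incl_adj (V i) \<phi>)))\<^sup>2 = 0"
    using finite_I by (subst (asm) sum_nonneg_eq_0_iff) auto
  then have "incl_adj (V i) \<phi> (Q i (incl_adj (V i) \<phi>)) = 0" if "i \<in> I" for i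
    using that N_Q_incl_adj_sq by metis
  then have "blinfun_apply \<phi> (u i) = 0" if "i \<in> I" for i
    using quadratic_space.dual_eq_0[OF quadratic incl_adj_in, of i \<phi> "u i"] that u
    by (simp add: incl_adj_apply PiE_mem)
  then show "blinfun_apply \<phi> v = blinfun_apply 0 v"
    using u(2) by (auto simp: Phi_def blinfun.sum_right)
qed

lemma inj_S: "inj S"
  using S_definite by (simp add: linear_injective_0[OF linear_S] blinfun.zero_right)

text \<open>Estimating each summand of \<open>S \<phi>\<close> through its own norm
  \<open>N i\<close> bounds the square of its ambient norm by a multiple of that norm times
  \<open>norm \<phi>\<close>; one factor then cancels.\<close>

lemma S_bounded: "\<exists>M. \<forall>\<phi>. norm (S \<phi>) \<le> M * norm \<phi>"
proof -
  obtain C where C: "\<And>i x. i \<in> I \<Longrightarrow> x \<in> V i \<Longrightarrow> norm x \<le> C i * N i x"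
    using incl_continuous by metis
  have bound: "norm (Q i (incl_adj (V i) \<phi>)) \<le> (C i)\<^sup>2 * norm \<phi>" if i: "i \<in> I" for i \<phi>
  proof -
    let ?x = "Q i (incl_adj (V i) \<phi>)"
    have "(norm ?x)\<^sup>2 \<le> (C i * N i ?x)\<^sup>2"
      using C i Q_incl_adj_in by (simp add: power_mono)
    also have "\<dots> = (C i)\<^sup>2 * blinfun_apply \<phi> ?x"
      using i by (simp add: power_mult_distrib N_Q_incl_adj_sq incl_adj_apply Q_incl_adj_in)
    also have "\<dots> \<le> (C i)\<^sup>2 * (norm \<phi> * norm ?x)"
      using norm_blinfun[of \<phi> ?x] by (intro mult_left_mono) auto
    finally have "norm ?x * norm ?x \<le> ((C i)\<^sup>2 * norm \<phi>) * norm ?x"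
      by (simp add: power2_eq_square mult.assoc)
    then show ?thesis
      by (cases "?x = 0") auto
  qed
  have "norm (S \<phi>) \<le> (\<Sum>i\<in>I. (C i)\<^sup>2) * norm \<phi>" for \<phi>
    unfolding S_op_def sum_distrib_right by (rule sum_norm_le) (rule bound)
  then show ?thesis
    by blast
qed

text \<open>
  Coercivity amounts to openness of \<^term>\<open>Phi I\<close>; working with the quadratic form on \<^typ>\<open>'v\<close> avoids the
  open mapping theorem on the product space.
\<close>

lemma S_coercive: "\<exists>c>0. \<forall>y. c * (norm y)\<^sup>2 \<le> y \<bullet> S (blinfun_inner_right y)"
proof -
  define a where "a y = y \<bullet> S (blinfun_inner_right y)" for y
  have a_apply: "a y = blinfun_apply (blinfun_inner_right y) (S (blinfun_inner_right y))" for y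
    by (simp add: a_def)
  have "\<exists>C. \<forall>y\<in>{y. a y \<le> 1}. \<bar>y \<bullet> v\<bar> \<le> C" for v
  proof -
    obtain u where u: "u \<in> Pi\<^sub>E I V" "Phi I u = v"
      by (rule decomposition)
    \<comment> \<open>The bound depends on the chosen decomposition \<open>u\<close> of
      \<open>v\<close>, but not on \<open>y\<close>.\<close>
    have "\<bar>y \<bullet> v\<bar> \<le> 1 + (\<Sum>i\<in>I. (N i (u i))\<^sup>2)" if y: "a y \<le> 1" for y
    proof -
      let ?\<psi> = "\<lambda>i. incl_adj (V i) (blinfun_inner_right y)"
      have "\<bar>y \<bullet> u i\<bar> \<le> (N i (Q i (?\<psi> i)))\<^sup>2 + (N i (u i))\<^sup>2" if i: "i \<in> I" for i
      proof -
        have "2 * \<bar>?\<psi> i (u i)\<bar> \<le> ?\<psi> i (Q i (?\<psi> i)) + (N i (u i))\<^sup>2"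
          using i u by (intro quadratic_space.dual_apply_bound[OF quadratic] incl_adj_in) auto
        then show ?thesis
          using i u by (simp add: incl_adj_apply PiE_mem flip: N_Q_incl_adj_sq)
      qed
      then have "(\<Sum>i\<in>I. \<bar>y \<bullet> u i\<bar>) \<le> a y + (\<Sum>i\<in>I. (N i (u i))\<^sup>2)"
        unfolding a_apply S_quadratic sum.distrib[symmetric] by (rule sum_mono)
      moreover have "\<bar>y \<bullet> v\<bar> \<le> (\<Sum>i\<in>I. \<bar>y \<bullet> u i\<bar>)"
        using u(2) by (auto simp: Phi_def inner_sum_right)
      ultimately show ?thesis
        using y by linarith
    qed
    then show ?thesis
      by blast
  qed
  then have "bounded {y. a y \<le> 1}"
    by (rule pointwise_bounded_imp_bounded)
  then obtain B where B: "B > 0" "\<And>y. a y \<le> 1 \<Longrightarrow> norm y \<le> B"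
    by (auto simp: bounded_pos)
  \<comment> \<open>\<open>a\<close> is homogeneous of degree 2 and positive off 0, so
    \<open>y\<close> can be rescaled to the level \<open>a = 1\<close>, where its norm is at most
    \<open>B\<close>.\<close>
  have "1 / B\<^sup>2 * (norm y)\<^sup>2 \<le> a y" for y
  proof (cases "y = 0")
    case False
    have "a y \<ge> 0"
      by (simp only: a_apply S_quadratic sum_nonneg zero_le_power2)
    moreover have "a y \<noteq> 0"
    proof
      assume "a y = 0"
      then have "blinfun_inner_right y = 0"
        unfolding a_apply by (rule S_definite)
      then have "y \<bullet> y = 0"
        by (metis blinfun.zero_left blinfun_inner_right.rep_eq)
      then show False
        using False by simp
    qed
    ultimately have pos: "a y > 0"
      by simp
    have "blinfun_inner_right (t *\<^sub>R y) = t *\<^sub>R blinfun_inner_right y" for t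
      by (rule blinfun_eqI) (simp add: blinfun.scaleR_left)
    then have "a (t *\<^sub>R y) = t\<^sup>2 * a y" for t
      by (simp add: a_def linear_cmul[OF linear_S] power2_eq_square)
    then have "a ((1 / sqrt (a y)) *\<^sub>R y) = 1"
      using pos by (simp add: power_divide)
    then have "norm ((1 / sqrt (a y)) *\<^sub>R y) \<le> B"
      using B(2) by (simp del: norm_scaleR)
    then have "norm y \<le> B * sqrt (a y)"
      using pos by (simp add: field_simps)
    then have "(norm y)\<^sup>2 \<le> (B * sqrt (a y))\<^sup>2"
      by (simp add: power_mono)
    then show ?thesis
      using pos B(1) by (simp add: power_mult_distrib field_simps)
  qed (simp add: a_def)
  then show ?thesis
    using B(1) by (intro exI[of _ "1 / B\<^sup>2"]) (simp add: a_def)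
qed

text \<open>Precomposition with the Riesz map \<open>blinfun_inner_right\<close> gives an
  endomorphism \<open>T\<close> to which Lax-Milgram applies. Surjectivity of \<open>T\<close>
  passes to \<open>S\<close>; injectivity comes from definiteness.\<close>

lemma bij_S: "bij S"
proof -
  define T where "T y = S (blinfun_inner_right y)" for y
  have "blinfun_inner_right (x + y) = blinfun_inner_right x + blinfun_inner_right y"
    "blinfun_inner_right (t *\<^sub>R y) = t *\<^sub>R blinfun_inner_right y" for x y :: 'v and t
    by (rule blinfun_eqI, simp add: blinfun.add_left blinfun.scaleR_left inner_add_left)+
  then have "linear T"
    by (intro linearI) (simp_all add: T_def linear_add[OF linear_S] linear_cmul[OF linear_S])
  moreover obtain M where M: "\<And>\<phi>. norm (S \<phi>) \<le> M * norm \<phi>"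
    using S_bounded by blast
  have "norm (blinfun_inner_right y) \<le> norm y" for y :: 'v
    by (rule norm_blinfun_bound) (auto simp: Cauchy_Schwarz_ineq2)
  then have "norm (T y) \<le> \<bar>M\<bar> * norm y" for y
    using M[of "blinfun_inner_right y"]
      mult_mono[of M "\<bar>M\<bar>" "norm (blinfun_inner_right y)" "norm y"]
    by (force simp: T_def)
  moreover obtain c where "c > 0" "\<And>y. c * (norm y)\<^sup>2 \<le> y \<bullet> T y"
    using S_coercive by (auto simp: T_def)
  ultimately have "surj T"
    by (rule lax_milgram_surj)
  then have "surj S"
    unfolding T_def surj_def by metis
  with inj_S show ?thesis
    by (simp add: bij_def)
qed

lemma S_inv: "S (inv S v) = v"
  by (rule surj_f_inv_f) (rule bij_is_surj[OF bij_S])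

lemma inv_S_add: "inv S (v + w) = inv S v + inv S w"
  by (rule inv_f_eq[OF inj_S]) (simp add: linear_add[OF linear_S] S_inv)

lemma inv_S_scale: "inv S (c *\<^sub>R v) = c *\<^sub>R inv S v"
  by (rule inv_f_eq[OF inj_S]) (simp add: linear_cmul[OF linear_S] S_inv)

section \<open>Minimal norm of \<open>Psi\<close> on the fibres of \<open>Phi\<close>\<close>

lemma Psi_in: "Psi I V Q v \<in> Pi\<^sub>E I V"
  by (simp add: Psi_def Q_incl_adj_in)

lemma Phi_Psi: "Phi I (Psi I V Q v) = v"
  using S_inv[of v] by (simp add: Phi_def Psi_def S_op_def)

lemma prod_norm_sq: "(prod_norm I N u)\<^sup>2 = (\<Sum>i\<in>I. (N i (u i))\<^sup>2)"
  by (simp add: prod_norm_def sum_nonneg)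

lemma prod_norm_nonneg: "0 \<le> prod_norm I N u"
  by (simp add: prod_norm_def sum_nonneg)

lemma prod_norm_Psi: "prod_norm I N (Psi I V Q v) = S_inv_norm I V Q v"
  using S_quadratic[of "inv S v"] by (simp add: prod_norm_def Psi_def S_inv_norm_def S_inv)

text \<open>The cross terms are pairings of \<open>inv S v\<close> with the \<open>k i\<close>; they
  add up to its value at \<open>Phi I k = 0\<close>. The case \<open>t = 1\<close> describes the
  whole fibre, and negative \<open>t\<close> serves the minmax problem.\<close>

lemma Psi_pythagoras:
  assumes k: "k \<in> Pi\<^sub>E I V" "Phi I k = 0"
  shows "(\<Sum>i\<in>I. (N i (Psi I V Q v i + t *\<^sub>R k i))\<^sup>2)
    = (prod_norm I N (Psi I V Q v))\<^sup>2 + t\<^sup>2 * (prod_norm I N k)\<^sup>2"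
proof -
  let ?\<phi> = "inv S v"
  have "(N i (Psi I V Q v i + t *\<^sub>R k i))\<^sup>2
      = (N i (Psi I V Q v i))\<^sup>2 + 2 * t * blinfun_apply ?\<phi> (k i) + t\<^sup>2 * (N i (k i))\<^sup>2"
    if "i \<in> I" for i
    using quadratic_space.N_expand[OF quadratic incl_adj_in, of i "k i" ?\<phi> t] that k
    by (simp add: Psi_def incl_adj_apply PiE_mem)
  then have "(\<Sum>i\<in>I. (N i (Psi I V Q v i + t *\<^sub>R k i))\<^sup>2)
      = (prod_norm I N (Psi I V Q v))\<^sup>2 + 2 * t * (\<Sum>i\<in>I. blinfun_apply ?\<phi> (k i))
        + t\<^sup>2 * (prod_norm I N k)\<^sup>2"
    by (simp add: sum.distrib prod_norm_sq sum_distrib_left)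
  moreover have "(\<Sum>i\<in>I. blinfun_apply ?\<phi> (k i)) = 0"
    using k(2) by (simp add: Phi_def blinfun.zero_right flip: blinfun.sum_right)
  ultimately show ?thesis
    by simp
qed

lemma diff_Psi_in_ker:
  assumes "w \<in> Pi\<^sub>E I V" "Phi I w = v"
  shows "prod_diff I w (Psi I V Q v) \<in> Pi\<^sub>E I V" "Phi I (prod_diff I w (Psi I V Q v)) = 0"
  using assms Psi_in[of v] Phi_Psi[of v] subspace_V
  by (auto simp: prod_diff_def Phi_def sum_subtractf PiE_iff subspace_diff)

lemma prod_norm_fibre:
  assumes "w \<in> Pi\<^sub>E I V" "Phi I w = v"
  shows "(prod_norm I N w)\<^sup>2
    = (prod_norm I N (Psi I V Q v))\<^sup>2 + (prod_norm I N (prod_diff I w (Psi I V Q v)))\<^sup>2"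
  using Psi_pythagoras[OF diff_Psi_in_ker[OF assms], of v 1]
  by (simp add: prod_norm_sq prod_diff_def)

text \<open>Distinct tuples in \<open>Pi\<^sub>E I V\<close> differ at an index in \<open>I\<close>,
  and definiteness of that one norm suffices.\<close>

lemma prod_norm_diff_pos:
  assumes "w \<in> Pi\<^sub>E I V" "u \<in> Pi\<^sub>E I V" "w \<noteq> u"
  shows "0 < (prod_norm I N (prod_diff I w u))\<^sup>2"
proof -
  obtain i where i: "i \<in> I" "w i \<noteq> u i"
    using assms by (metis PiE_ext)
  then have "w i - u i \<in> V i"
    using assms subspace_V by (auto intro: subspace_diff)
  then have "N i (w i - u i) \<noteq> 0"
    using quadratic_space.N_eq_0_imp[OF quadratic] i by fastforce
  then show ?thesis
    unfolding prod_norm_sq using i finite_I by (intro sum_pos2[of _ i]) (auto simp: prod_diff_def)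
qed

lemma prod_norm_Psi_less:
  assumes "w \<in> Pi\<^sub>E I V" "Phi I w = v" "w \<noteq> Psi I V Q v"
  shows "prod_norm I N (Psi I V Q v) < prod_norm I N w"
  using prod_norm_fibre[OF assms(1,2)] prod_norm_diff_pos[OF assms(1) Psi_in assms(3)]
  by (intro power2_less_imp_less[OF _ prod_norm_nonneg]) simp

section \<open>The minmax problem\<close>

lemma worst_rel_error_Psi: "worst_rel_error I V N v (Psi I V Q v) \<le> 1"
  unfolding worst_rel_error_def
proof (rule SUP_least)
  fix u
  assume "u \<in> {u \<in> Pi\<^sub>E I V. Phi I u = v \<and> u \<noteq> prod_zero I}"
  then have "(prod_norm I N (prod_diff I u (Psi I V Q v)))\<^sup>2 \<le> (prod_norm I N u)\<^sup>2"
    by (simp add: prod_norm_fibre)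
  then have "prod_norm I N (prod_diff I u (Psi I V Q v)) \<le> prod_norm I N u"
    by (rule power2_le_imp_le) (rule prod_norm_nonneg)
  \<comment> \<open>For a zero denominator the quotient is 0 by convention.\<close>
  then show "ennreal (prod_norm I N (prod_diff I u (Psi I V Q v)) / prod_norm I N u) \<le> 1"
    using prod_norm_nonneg[of u] by (auto simp: divide_le_eq_1 less_le)
qed

text \<open>
  The witness \<open>u = \<Psi> v - t k\<close>, with \<open>k = w - \<Psi> v\<close>, lies on the far side of \<open>\<Psi> v\<close>: for large \<open>t\<close> the error
  \<open>(1 + t) \<parallel>k\<parallel>\<close> beats \<open>\<parallel>u\<parallel>\<close>, which is about \<open>t \<parallel>k\<parallel>\<close>.
\<close>

lemma worst_rel_error_gt_1:
  assumes w: "w \<in> Pi\<^sub>E I V" "Phi I w = v" "w \<noteq> Psi I V Q v"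
  shows "1 < worst_rel_error I V N v w"
proof -
  define k where "k = prod_diff I w (Psi I V Q v)"
  define p where "p = (prod_norm I N (Psi I V Q v))\<^sup>2"
  define q where "q = (prod_norm I N k)\<^sup>2"
  \<comment> \<open>The aim is \<open>p + t\<^sup>2 * q < (1 + t)\<^sup>2 * q\<close>. Since
    \<open>t * q = p + q\<close>, the two sides differ by \<open>p + 3 * q\<close>.\<close>
  define t where "t = p / q + 1"
  define u where "u = (\<lambda>i\<in>I. Psi I V Q v i + (- t) *\<^sub>R k i)"
  have k: "k \<in> Pi\<^sub>E I V" "Phi I k = 0"
    unfolding k_def using w(1,2) by (rule diff_Psi_in_ker)+
  have "q > 0" "p \<ge> 0"
    using prod_norm_diff_pos[OF w(1) Psi_in w(3)] by (auto simp: q_def k_def p_def)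
  then have "t > 0" "t * q = p + q"
    by (auto simp: t_def field_simps intro: add_nonneg_pos)
  have u_fibre: "u \<in> Pi\<^sub>E I V" "Phi I u = v"
  proof -
    show "u \<in> Pi\<^sub>E I V"
      unfolding u_def using k(1) Psi_in[of v] subspace_V
      by (auto simp: PiE_iff intro!: subspace_diff subspace_scale)
    have "Phi I u = Phi I (Psi I V Q v) - t *\<^sub>R Phi I k"
      by (simp add: u_def Phi_def sum_subtractf scaleR_sum_right)
    then show "Phi I u = v"
      using k(2) Phi_Psi by simp
  qed
  have norm_u: "(prod_norm I N u)\<^sup>2 = p + t\<^sup>2 * q"
    using Psi_pythagoras[OF k, of v "- t"] by (simp add: p_def q_def u_def prod_norm_sq)
  have norm_diff: "(prod_norm I N (prod_diff I u w))\<^sup>2 = (1 + t)\<^sup>2 * q"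
  proof -
    \<comment> \<open>\<open>u\<close> and \<open>w\<close> are the points with parameters
      \<open>- t\<close> and 1 on the line through \<open>Psi I V Q v\<close> in direction
      \<open>k\<close>.\<close>
    have "prod_diff I u w i = (- (1 + t)) *\<^sub>R k i" if "i \<in> I" for i
      using that by (simp add: prod_diff_def u_def k_def algebra_simps)
    then have "(prod_norm I N (prod_diff I u w))\<^sup>2 = (\<Sum>i\<in>I. (- (1 + t))\<^sup>2 * (N i (k i))\<^sup>2)"
      unfolding prod_norm_sq
      using k(1) quadratic_space.N_scale_sq[OF quadratic] by (intro sum.cong) (auto simp: PiE_mem)
    then show ?thesis
      by (simp only: q_def prod_norm_sq sum_distrib_left power2_minus)
  qed
  have u_pos: "0 < prod_norm I N u"
  proof -
    have "0 < (prod_norm I N u)\<^sup>2"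
      using \<open>q > 0\<close> \<open>p \<ge> 0\<close> \<open>t > 0\<close> by (simp add: norm_u add_nonneg_pos)
    then show ?thesis
      using prod_norm_nonneg[of u] by (auto simp: less_le)
  qed
  \<comment> \<open>The supremum ranges over nonzero tuples only. Scaling by 0 in
    \<open>N_scale_sq\<close> shows that the zero tuple has norm 0.\<close>
  have "u \<noteq> prod_zero I"
  proof
    assume "u = prod_zero I"
    then have "(prod_norm I N u)\<^sup>2 = 0"
      using quadratic_space.N_scale_sq[OF quadratic, of _ 0 0] subspace_V
      by (auto simp: prod_norm_sq prod_zero_def subspace_0 intro!: sum.neutral)
    with u_pos show False
      by simp
  qed
  moreover have "1 < ennreal (prod_norm I N (prod_diff I u w) / prod_norm I N u)"
  proof -
    have "(prod_norm I N u)\<^sup>2 < (prod_norm I N (prod_diff I u w))\<^sup>2"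
      unfolding norm_u norm_diff using \<open>t * q = p + q\<close> \<open>q > 0\<close> \<open>p \<ge> 0\<close>
      by (simp add: power2_eq_square algebra_simps)
    then have "prod_norm I N u < prod_norm I N (prod_diff I u w)"
      by (rule power2_less_imp_less) (rule prod_norm_nonneg)
    then have "1 < prod_norm I N (prod_diff I u w) / prod_norm I N u"
      using u_pos by simp
    then show ?thesis
      by (simp flip: ennreal_1 add: ennreal_less_iff)
  qed
  ultimately show ?thesis
    unfolding worst_rel_error_def less_SUP_iff using u_fibre by blast
qed

section \<open>The isometries and the final assembly\<close>

lemma Psi_isometry:
  "linear_isometry (S_inv_norm I V Q) (Pi\<^sub>E I V) (prod_add I (\<lambda>i. (+)))
    (prod_scale I (\<lambda>i. scaleR)) (prod_norm I N) (Psi I V Q)"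
  unfolding linear_isometry_def
  using Psi_in prod_norm_Psi
  by (auto simp: prod_add_def prod_scale_def Psi_def inv_S_add inv_S_scale
      Q_incl_adj_add Q_incl_adj_scale)

text \<open>Under the square root, both norms are the sum of squares in
  \<open>S_quadratic\<close>.\<close>

lemma Phi_adj_isometry:
  "linear_isometry (S_norm I V Q) (Pi\<^sub>E I (\<lambda>i. normed_dual (V i) (N i)))
    (prod_add I (\<lambda>i. dual_add (V i))) (prod_scale I (\<lambda>i. dual_scale (V i)))
    (prod_dual_norm I Q) (Phi_adj I V)"
  unfolding linear_isometry_def
  by (auto simp: prod_add_def prod_scale_def Phi_adj_def incl_adj_in incl_adj_add incl_adj_scale
      prod_dual_norm_def S_norm_def S_quadratic N_Q_incl_adj_sq)

end

text \<open>Strict inequality against every competitor yields minimality and uniqueness at once. The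
  general order covers both the real-valued norm and the \<open>ennreal\<close>-valued worst
  error.\<close>

lemma is_arg_min_iff_eq:
  fixes f :: "'a \<Rightarrow> 'b::order"
  assumes "P x" "\<And>y. P y \<Longrightarrow> y \<noteq> x \<Longrightarrow> f x < f y"
  shows "is_arg_min f P w \<longleftrightarrow> w = x"
  using assms unfolding is_arg_min_def by (metis less_asym less_irrefl)

theorem theorem3p3:
  fixes I :: "'i set"
    and V :: "'i \<Rightarrow> 'v::{real_inner, complete_space} set"
    and N :: "'i \<Rightarrow> 'v \<Rightarrow> real"
    and Q :: "'i \<Rightarrow> ('v \<Rightarrow> real) \<Rightarrow> 'v"
  assumes separable: "separable_space (euclidean :: 'v topology)"
    and finite_I: "finite I"
    and subspaces: "\<And>i. i \<in> I \<Longrightarrow> subspace (V i)"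
    and sum_V: "{\<Sum>i\<in>I. u i | u. u \<in> Pi\<^sub>E I V} = UNIV"
    and hilbert: "\<And>i. i \<in> I \<Longrightarrow> hilbert_norm_on (V i) (N i)"
    and Q: "\<And>i. i \<in> I \<Longrightarrow> pos_sym_bijection (V i) (N i) (Q i)"
    and norm_Q: "\<And>i x. i \<in> I \<Longrightarrow> x \<in> V i \<Longrightarrow>
                   (N i x)\<^sup>2 = (inv_into (normed_dual (V i) (N i)) (Q i) x) x"
    and incl_continuous: "\<And>i. i \<in> I \<Longrightarrow> \<exists>C. \<forall>x\<in>V i. norm x \<le> C * N i x"
  shows "bij (S_op I V Q)
    \<and> (\<forall>v w. is_arg_min (prod_norm I N) (\<lambda>w. w \<in> Pi\<^sub>E I V \<and> Phi I w = v) w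
               \<longleftrightarrow> w = Psi I V Q v)
    \<and> (\<forall>v w. is_arg_min (worst_rel_error I V N v) (\<lambda>w. w \<in> Pi\<^sub>E I V \<and> Phi I w = v) w
               \<longleftrightarrow> w = Psi I V Q v)
    \<and> (\<forall>v. Phi I (Psi I V Q v) = v)
    \<and> linear_isometry (S_inv_norm I V Q)
        (Pi\<^sub>E I V) (prod_add I (\<lambda>i. (+))) (prod_scale I (\<lambda>i. scaleR)) (prod_norm I N)
        (Psi I V Q)
    \<and> linear_isometry (S_norm I V Q)
        (Pi\<^sub>E I (\<lambda>i. normed_dual (V i) (N i)))
        (prod_add I (\<lambda>i. dual_add (V i))) (prod_scale I (\<lambda>i. dual_scale (V i))) (prod_dual_norm I Q)
        (Phi_adj I V)
    \<and> (\<forall>v. (S_inv_norm I V Q v)\<^sup>2 = (prod_norm I N (Psi I V Q v))\<^sup>2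
          \<and> (prod_norm I N (Psi I V Q v))\<^sup>2 = (\<Sum>i\<in>I. (N i (Psi I V Q v i))\<^sup>2))"
proof -
  interpret subspace_family I V N Q
    using assms by (simp add: subspace_family_def quadratic_space_def)
  have "is_arg_min (prod_norm I N) (\<lambda>w. w \<in> Pi\<^sub>E I V \<and> Phi I w = v) w
      \<longleftrightarrow> w = Psi I V Q v" for v w
    by (rule is_arg_min_iff_eq) (auto simp: Psi_in Phi_Psi prod_norm_Psi_less)
  moreover have "is_arg_min (worst_rel_error I V N v) (\<lambda>w. w \<in> Pi\<^sub>E I V \<and> Phi I w = v) w
      \<longleftrightarrow> w = Psi I V Q v" for v w
    \<comment> \<open>The value 1 separates \<open>Psi I V Q v\<close> from all other points of the
      fibre.\<close>
    by (rule is_arg_min_iff_eq)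
      (auto simp: Psi_in Phi_Psi intro: le_less_trans[OF worst_rel_error_Psi worst_rel_error_gt_1])
  ultimately show ?thesis
    using bij_S Phi_Psi Psi_isometry Phi_adj_isometry by (simp add: prod_norm_Psi prod_norm_sq
        flip: prod_norm_Psi)
qed

end
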